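(* Let $(a_j)_{j\ge 0}$ be a real sequence with $a_0=0$, $a_j\ge 0$ for all $j\ge 1$, $a_2>0$, and $a_j\le C\rho^j$ for all $j \geq 0$, for some constants $C,\rho>0$. Let $E$, $D$, $p_{N,j}$ and $p_j$ be defined from $(a_j)$ as in the context. Then for every even integer $N\ge 4$, $$\frac12\sum_{j\ge 2,\ j\text{ even}}|p_{N,j}-p_j|\le \min\left\{1,\ \frac{3E(2\pi)}{D}\,2^{-N}\right\}.$$ Consequently, as $N\to\infty$ through even integers, $p_{N,j}\to p_j$ uniformly in the even index $j \geq 2$.
   Context: $\zeta$ denotes the Riemann zeta function (meromorphically continued). For a sequence $(a_j)$ as in the claim, set $$E(t)=\sum_{j\ge 2,\ j\text{ even}} a_j\frac{t^j}{j!},\qquad w_j=\frac{a_j\pi^j}{j!}\ (j\ge 2\text{ even}),\qquad D=E(\pi)>0.$$ For an even integer $N\ge 4$ set $$t_{N,j}=N\binom{N-1}{j}a_j\,2^{N-j-1}\zeta(j+1-N)\quad(1\le j\le N-2),\qquad M_N=\sum_{j=1}^{N-2}|t_{N,j}|.$$ (Terms with odd $j$ vanish.) For even $j$ define $$p_{N,j}=\frac{|t_{N,j}|}{M_N}\ (2\le j\le N-2),\qquad p_{N,j}=0\ (j\ge N),\qquad p_j=\frac{w_j}{D}\ (j\ge 2).$$ Both $(p_{N,j})_j$ and $(p_j)_j$ are probability distributions on the positive even integers. *)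

theory Defs
  imports "HOL-Complex_Analysis.Complex_Analysis"
begin

(* The Riemann zeta function as the analytic continuation of its Dirichlet series: the
   complement of {1} is connected, so the conditions determine the function uniquely.
   The value 0 at the pole s = 1 is a mere convention. *)
definition zeta :: "complex \<Rightarrow> complex" where
  "zeta = (THE f. f holomorphic_on - {1} \<and>
                  (\<forall>s. Re s > 1 \<longrightarrow> (\<lambda>n. 1 / of_nat (Suc n) powr s) sums f s) \<and>
                  f 1 = 0)"

definition pos_evens :: "nat set" where
  "pos_evens = {j. even j \<and> 2 \<le> j}"

definition E :: "(nat \<Rightarrow> real) \<Rightarrow> real \<Rightarrow> real" where
  "E a t = (\<Sum>\<^sub>\<infinity>j\<in>pos_evens. a j * t ^ j / fact j)"

definition w :: "(nat \<Rightarrow> real) \<Rightarrow> nat \<Rightarrow> real" where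
  "w a j = a j * pi ^ j / fact j"

definition D :: "(nat \<Rightarrow> real) \<Rightarrow> real" where
  "D a = E a pi"

(* Complex-valued only because zeta is; it is used for 1 \<le> j \<le> N - 2, where the subtraction
   in the exponent of 2 does not truncate. *)
definition t_coeff :: "(nat \<Rightarrow> real) \<Rightarrow> nat \<Rightarrow> nat \<Rightarrow> complex" where
  "t_coeff a N j =
     of_nat N * of_nat ((N - 1) choose j) * of_real (a j) * 2 ^ (N - j - 1)
       * zeta (of_nat j + 1 - of_nat N)"

definition M :: "(nat \<Rightarrow> real) \<Rightarrow> nat \<Rightarrow> real" where
  "M a N = (\<Sum>j = 1..N - 2. cmod (t_coeff a N j))"

definition p_fin :: "(nat \<Rightarrow> real) \<Rightarrow> nat \<Rightarrow> nat \<Rightarrow> real" where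
  "p_fin a N j = (if j \<in> pos_evens \<and> j \<le> N - 2 then cmod (t_coeff a N j) / M a N else 0)"

definition p_lim :: "(nat \<Rightarrow> real) \<Rightarrow> nat \<Rightarrow> real" where
  "p_lim a j = w a j / D a"

end

theory Submission
  imports Defs "HOL-Real_Asymp.Real_Asymp"
begin

text \<open>
  Write \<open>Z(n)\<close> for the real series \<open>\<Sum>k\<ge>1. 1 / k^n\<close>. The known values of zeta at negative integers
  turn \<open>|t_{N,j}|\<close> into \<open>N! \<pi>^{-N} w_j Z(N - j)\<close> for even \<open>j\<close> and into \<open>0\<close> for odd \<open>j\<close>. Since
  \<open>1 \<le> Z(n) \<le> 1 + 3 / 2^n\<close>, the unnormalised weights \<open>w_j Z(N - j)\<close> (or \<open>0\<close> for \<open>j \<ge> N\<close>) differ from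
  \<open>w_j\<close> by at most \<open>3 w_j 2^{j - N}\<close>, and these errors sum to \<open>3 E(2\<pi>) 2^{-N}\<close>. Normalising by the larger
  of the two total masses costs nothing in the appropriate one-sided form of the total variation.

  For the zeta values, split Riemann's integral \<open>\<Gamma>(s) \<zeta>(s) = \<integral> x^{s-1} / (e^x - 1)\<close> at \<open>x = 1\<close>. The part over
  \<open>[1, \<infinity>)\<close> is entire. On \<open>[0, 1]\<close> one integrates termwise the expansion
  \<open>1 / (e^x - 1) = 1 / x - 1 / 2 + \<Sum>j. c_j x^{2j+1}\<close> with \<open>c_j = 2 (-1)^j Z(2j + 2) / (2\<pi>)^{2j+2}\<close>, which
  comes from the partial fractions of the cotangent. After multiplication by \<open>1 / \<Gamma>(s)\<close> all poles but \<open>s = 1\<close>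
  cancel, and the value at \<open>s = - (2j + 1)\<close> is read off from \<open>c_j\<close>, with no Bernoulli numbers involved.
\<close>

subsection \<open>The power series of the Bose factor\<close>

text \<open>Differentiating the reflection formula
  \<open>rGamma w * rGamma (1 - w) = sin (pi * w) / pi\<close> and dividing by the product expresses
  \<open>pi * cot (pi * z)\<close> as \<open>Digamma (1 - z) - Digamma z\<close>; the Digamma series
  supplies the partial fractions.\<close>

lemma cot_partial_fractions:
  fixes z :: complex
  assumes z: "z \<notin> \<int>"
  shows "(\<lambda>n. 1 / (z + of_nat (Suc n)) + 1 / (z - of_nat (Suc n)))
           sums (of_real pi * cot (of_real pi * z) - 1 / z)"
proof -
  have z': "1 - z \<notin> \<int>"
    using z by (metis Ints_1 Ints_diff diff_diff_eq2 add_diff_cancel_left')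
  have np: "z \<notin> \<int>\<^sub>\<le>\<^sub>0" "1 - z \<notin> \<int>\<^sub>\<le>\<^sub>0"
    using z z' nonpos_Ints_subset_Ints by auto
  have nz: "z \<noteq> 0" "1 - z \<noteq> 0"
    using z z' by (metis Ints_0)+
  have eq: "rGamma w * rGamma (1 - w) = sin (of_real pi * w) / of_real pi" for w :: complex
    by (rule rGamma_reflection_complex)
  have "((\<lambda>w. rGamma w * rGamma (1 - w)) has_field_derivative
          (rGamma z * rGamma (1 - z) * (Digamma (1 - z) - Digamma z))) (at z)"
    using np by (auto intro!: derivative_eq_intros simp: algebra_simps)
  moreover have "((\<lambda>w. sin (of_real pi * w) / of_real pi) has_field_derivative
          cos (of_real pi * z)) (at z)"
    by (auto intro!: derivative_eq_intros)
  ultimately have "rGamma z * rGamma (1 - z) * (Digamma (1 - z) - Digamma z) = cos (of_real pi * z)"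
    unfolding eq using DERIV_unique by blast
  moreover have "rGamma z * rGamma (1 - z) \<noteq> 0"
    using np by (simp add: rGamma_eq_zero_iff)
  ultimately have dig: "Digamma (1 - z) - Digamma z = of_real pi * cot (of_real pi * z)"
    unfolding eq cot_def by (simp add: field_simps)
  have s1: "(\<lambda>n. inverse (z + of_nat n) - inverse (1 - z + of_nat n)) sums
              (Digamma (1 - z) - Digamma z)"
    using sums_diff[OF summable_sums[OF summable_Digamma[OF nz(2)]]
                       summable_sums[OF summable_Digamma[OF nz(1)]]]
    by (simp add: Digamma_def)
  \<comment> \<open>This telescoping series has sum \<open>- 1 / z\<close>. Adding it moves the
    poles of the first summands from \<open>- n\<close> to \<open>- Suc n\<close>.\<close>
  have s2: "(\<lambda>n. inverse (z + of_nat (Suc n)) - inverse (z + of_nat n)) sums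
                       (0 - inverse (z + of_nat 0))"
    by (intro telescope_sums filterlim_compose[OF tendsto_inverse_0]
              tendsto_add_filterlim_at_infinity[OF tendsto_const] tendsto_of_nat)
  have rw: "- inverse (1 - z + of_nat n) = 1 / (z - of_nat (Suc n))" for n
  proof -
    have "z - of_nat (Suc n) = - (1 - z + of_nat n)" by simp
    then show ?thesis by (simp only: inverse_eq_divide minus_divide_right)
  qed
  show ?thesis
    using sums_add[OF s1 s2] unfolding dig rw[symmetric] inverse_eq_divide
    by (simp add: add.commute)
qed

text \<open>The cotangent expansion is read on the imaginary axis at
  \<open>z = \<i> * x / (2 * pi)\<close>. There \<open>cot (pi * z)\<close> equals
  \<open>- \<i> * coth (x / 2)\<close>, and half of \<open>coth (x / 2)\<close> is
  \<open>1 / (exp x - 1) + 1 / 2\<close>.\<close>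

lemma exp_partial_fractions:
  fixes x :: real
  assumes x: "x > 0"
  shows "(\<lambda>n. 2 * x / (x\<^sup>2 + (2 * pi * real (Suc n))\<^sup>2)) sums (1 / (exp x - 1) - 1 / x + 1 / 2)"
proof -
  define z where "z = \<i> * of_real (x / (2 * pi))"
  have Imz: "Im z \<noteq> 0" using x by (simp add: z_def)
  have "z \<notin> \<int>" using Imz by (auto elim!: Ints_cases)
  hence S: "(\<lambda>n. 1 / (z + of_nat (Suc n)) + 1 / (z - of_nat (Suc n)))
           sums (of_real pi * cot (of_real pi * z) - 1 / z)"
    by (rule cot_partial_fractions)
  have c: "\<i> / (2 * of_real pi) * (1 / (z + of_nat (Suc n)) + 1 / (z - of_nat (Suc n))) =
        of_real (2 * x / (x\<^sup>2 + (2 * pi * real (Suc n))\<^sup>2))" for n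
  proof -
    have nz: "z + of_nat (Suc n) \<noteq> 0" "z - of_nat (Suc n) \<noteq> 0"
      using Imz by (auto simp: complex_eq_iff simp del: of_nat_Suc)
    define m where "m = real (Suc n)"
    have m: "of_nat (Suc n) = complex_of_real m" by (simp add: m_def)
    have pos: "x\<^sup>2 + (2 * pi * m)\<^sup>2 > 0" using x by (simp add: add_pos_nonneg)
    have "1 / (z + of_nat (Suc n)) + 1 / (z - of_nat (Suc n)) = 2 * z / (z\<^sup>2 - of_real m ^ 2)"
      using nz unfolding m by (simp add: field_simps power2_eq_square)
    also have "z\<^sup>2 - of_real m ^ 2 = - of_real ((x\<^sup>2 + (2 * pi * m)\<^sup>2) / (2 * pi)\<^sup>2)"
      by (simp add: z_def power_mult_distrib power_divide add_divide_distrib)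
    finally have "1 / (z + of_nat (Suc n)) + 1 / (z - of_nat (Suc n)) =
        2 * z / (- of_real ((x\<^sup>2 + (2 * pi * m)\<^sup>2) / (2 * pi)\<^sup>2))" .
    moreover have "\<i> / (2 * of_real pi) * (2 * z / (- of_real v)) = of_real (x / (2 * pi) / (pi * v))" for v
      unfolding z_def by (cases "v = 0") (simp_all add: field_simps)
    moreover have "x / (2 * pi) / (pi * ((x\<^sup>2 + (2 * pi * m)\<^sup>2) / (2 * pi)\<^sup>2)) =
        2 * x / (x\<^sup>2 + (2 * pi * m)\<^sup>2)"
      using pos by (simp add: power2_eq_square)
    ultimately show ?thesis by (simp only: m_def)
  qed
  have l: "\<i> / (2 * of_real pi) * (of_real pi * cot (of_real pi * z) - 1 / z) =
        of_real (1 / (exp x - 1) - 1 / x + 1 / 2)"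
  proof -
    define y where "y = exp (x / 2)"
    have ex: "exp x = y\<^sup>2" by (simp add: y_def power2_eq_square flip: exp_add)
    have y1: "y > 1" using x by (simp add: y_def)
    have y2: "y\<^sup>2 > 1" using y1 by (simp add: one_less_power)
    have a: "exp (\<i> * (of_real pi * z)) = of_real (inverse y)"
       "exp (- (\<i> * (of_real pi * z))) = of_real y"
      using exp_of_real[where 'a = complex, of "x / 2"] exp_of_real[where 'a = complex, of "- (x / 2)"]
      by (simp_all add: z_def y_def flip: exp_minus)
    have "cot (of_real pi * z) = (of_real (inverse y) + of_real y) / 2 /
        ((of_real (inverse y) - of_real y) / (2 * \<i>))"
      unfolding cot_def sin_exp_eq cos_exp_eq a ..
    also have "\<dots> = - \<i> * of_real ((y\<^sup>2 + 1) / (y\<^sup>2 - 1))"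
    proof -
      have "complex_of_real (y\<^sup>2 - 1) \<noteq> 0" using y2 by (simp only: of_real_eq_0_iff)
      then show ?thesis using y1 by (simp add: field_simps power2_eq_square)
    qed
    finally have ct: "cot (of_real pi * z) = - \<i> * of_real ((y\<^sup>2 + 1) / (y\<^sup>2 - 1))" .
    have "\<i> / (2 * of_real pi) * (of_real pi * cot (of_real pi * z) - 1 / z) =
       of_real ((y\<^sup>2 + 1) / (y\<^sup>2 - 1) / 2 - 1 / x)"
    proof -
      have "\<i> / (2 * of_real pi) * (of_real pi * (- \<i> * of_real c) - 1 / z) = of_real (c / 2 - 1 / x)" for c
        using x by (simp add: z_def field_simps)
      then show ?thesis unfolding ct .
    qed
    also have "(y\<^sup>2 + 1) / (y\<^sup>2 - 1) / 2 - 1 / x = 1 / (exp x - 1) - 1 / x + 1 / 2"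
      unfolding ex using x y2 by (simp add: field_simps)
    finally show ?thesis .
  qed
  show ?thesis
    using sums_mult[OF S, of "\<i> / (2 * of_real pi)"] unfolding c l sums_of_real_iff .
qed

text \<open>This is \<open>Z(n)\<close>, the zeta value at an integer \<open>n \<ge> 2\<close>, kept
  as a real series independent of the continuation.\<close>

definition recip_sum :: "nat \<Rightarrow> real" where
  "recip_sum n = (\<Sum>k. 1 / real (Suc k) ^ n)"

lemma recip_sums:
  assumes "n \<ge> 2"
  shows "(\<lambda>k. 1 / real (Suc k) ^ n) sums recip_sum n"
proof -
  have "summable (\<lambda>k. 1 / real (Suc k) ^ n)"
    using inverse_power_summable[OF assms, where ?'a = real]
    by (subst summable_Suc_iff) (simp add: inverse_eq_divide)
  then show ?thesis unfolding recip_sum_def by (rule summable_sums)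
qed

text \<open>The tail from the second term on is compared with exponent 2: for
  \<open>m \<ge> 2\<close>, \<open>1 / m ^ n\<close> is at most \<open>4 / 2 ^ n\<close> times
  \<open>1 / m ^ 2\<close>. Euler's value \<open>pi\<^sup>2 / 6\<close> and
  \<open>pi \<le> 3.2\<close> then give the constant 3.\<close>

lemma recip_sum_bounds:
  assumes "n \<ge> 2"
  shows "1 \<le> recip_sum n" "recip_sum n \<le> 1 + 3 / 2 ^ n"
proof -
  have S: "(\<lambda>k. 1 / real (Suc (Suc k)) ^ n) sums (recip_sum n - 1)"
    using recip_sums[OF assms] by (subst sums_Suc_iff) simp
  have S2: "(\<lambda>k. 1 / real (Suc (Suc k)) ^ 2) sums (pi\<^sup>2 / 6 - 1)"
    using inverse_squares_sums by (subst sums_Suc_iff) (simp add: add.commute)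
  have "0 \<le> recip_sum n - 1"
    by (rule sums_le[OF _ sums_zero S]) simp
  then show "1 \<le> recip_sum n" by simp
  have le: "1 / real (Suc (Suc k)) ^ n \<le> 4 / 2 ^ n * (1 / real (Suc (Suc k)) ^ 2)" for k
  proof -
    obtain m where m: "n = m + 2" using assms by (metis add.commute le_Suc_ex)
    have "(2::real) ^ m \<le> real (Suc (Suc k)) ^ m" by (intro power_mono) auto
    then have "4 / real (Suc (Suc k)) ^ m \<le> 4 / 2 ^ m" by (intro divide_left_mono) auto
    then have "4 / real (Suc (Suc k)) ^ m * (1 / (4 * real (Suc (Suc k)) ^ 2)) \<le>
        4 / 2 ^ m * (1 / (4 * real (Suc (Suc k)) ^ 2))" by (intro mult_right_mono) auto
    then show ?thesis unfolding m by (simp add: power_add mult.commute del: of_nat_Suc power_Suc add_2_eq_Suc')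
  qed
  have "recip_sum n - 1 \<le> 4 / 2 ^ n * (pi\<^sup>2 / 6 - 1)"
    by (rule sums_le[OF le S sums_mult[OF S2]])
  also have "\<dots> \<le> 4 / 2 ^ n * (3 / 4)"
  proof (intro mult_left_mono)
    have "pi\<^sup>2 \<le> (3.2)\<^sup>2" using pi_approx by (intro power_mono) auto
    then show "pi\<^sup>2 / 6 - 1 \<le> 3 / 4" by (simp add: power2_eq_square)
  qed simp
  finally show "recip_sum n \<le> 1 + 3 / 2 ^ n" by simp
qed

text \<open>The \<open>c_j\<close> of the expansion; in classical terms the Bernoulli quotient
  B_{2j+2} / (2j+2)!.\<close>

definition exp_coeff :: "nat \<Rightarrow> real" where
  "exp_coeff j = 2 * (-1) ^ j * recip_sum (2 * j + 2) / (2 * pi) ^ (2 * j + 2)"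

lemma abs_exp_coeff: "\<bar>exp_coeff j\<bar> = 2 * recip_sum (2 * j + 2) / (2 * pi) ^ (2 * j + 2)"
  using recip_sum_bounds(1)[of "2 * j + 2"] by (simp add: exp_coeff_def abs_mult power_abs)

text \<open>Replacing \<open>2 * pi\<close> by 2 discards most of the decay, but any geometric ratio
  below 1 makes the coefficients absolutely summable.\<close>

lemma abs_exp_coeff_le: "\<bar>exp_coeff j\<bar> \<le> (1 / 4) ^ j"
proof -
  have "recip_sum (2 * j + 2) \<le> 1 + 3 / 2 ^ (2 * j + 2)"
    by (rule recip_sum_bounds) simp
  also have "\<dots> \<le> 2"
  proof -
    have "(2::real) ^ 2 \<le> 2 ^ (2 * j + 2)" by (intro power_increasing) auto
    then have "3 \<le> (2::real) ^ (2 * j + 2)" by (simp del: power_Suc add_2_eq_Suc')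
    then show ?thesis by (simp add: divide_le_eq del: power_Suc add_2_eq_Suc')
  qed
  finally have 1: "recip_sum (2 * j + 2) \<le> 2" .
  have "(2::real) ^ (2 * j + 2) \<le> (2 * pi) ^ (2 * j + 2)"
    using pi_approx by (intro power_mono) auto
  then have "2 * recip_sum (2 * j + 2) / (2 * pi) ^ (2 * j + 2) \<le> 4 / 2 ^ (2 * j + 2)"
    using 1 recip_sum_bounds(1)[of "2 * j + 2"] by (intro frac_le) auto
  also have "\<dots> = (1 / 4) ^ j" by (simp add: power_add power_mult power_divide)
  finally show ?thesis unfolding abs_exp_coeff .
qed

lemma summable_norm_exp_coeff: "summable (\<lambda>j. \<bar>exp_coeff j\<bar>)"
  by (rule summable_comparison_test'[of "\<lambda>j. (1 / 4) ^ j" 0])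
     (auto intro: summable_geometric simp: abs_exp_coeff_le)

text \<open>Each partial fraction is a geometric series with ratio \<open>- q n\<close>. It is cut
  after \<open>J\<close> terms with its exact remainder, so only finitely many series are added at a
  time. Since \<open>1 / (1 + q n) \<le> 1\<close>, the summed remainders are bounded by the first
  omitted term, which tends to 0.\<close>

lemma exp_power_series:
  fixes x :: real
  assumes x: "0 < x" "x \<le> 1"
  shows "(\<lambda>j. exp_coeff j * x ^ (2 * j + 1)) sums (1 / (exp x - 1) - 1 / x + 1 / 2)"
proof -
  define L where "L = 1 / (exp x - 1) - 1 / x + 1 / 2"
  define q where "q n = (x / (2 * pi)) ^ 2 / real (Suc n) ^ 2" for n
  have q0: "q n \<ge> 0" for n by (simp add: q_def)
  have L: "(\<lambda>n. 2 / x * (q n / (1 + q n))) sums L"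
  proof -
    have "2 * x / (x\<^sup>2 + (2 * pi * real (Suc n))\<^sup>2) = 2 / x * (q n / (1 + q n))" for n
    proof -
      define B where "B = (2 * pi * real (Suc n))\<^sup>2"
      have B: "B > 0" by (simp add: B_def)
      have q: "q n = x\<^sup>2 / B"
        by (simp add: q_def B_def power_divide power_mult_distrib)
      have "x\<^sup>2 + B > 0" using x B by (simp add: add_pos_pos)
      moreover have "1 + q n = (x\<^sup>2 + B) / B"
        using B by (simp add: q field_simps)
      ultimately show ?thesis using x B
        unfolding B_def[symmetric] q by (simp add: power2_eq_square)
    qed
    then show ?thesis using exp_partial_fractions[OF x(1)] by (simp add: L_def)
  qed
  have Q: "(\<lambda>n. q n ^ Suc j) sums ((x / (2 * pi)) ^ (2 * Suc j) * recip_sum (2 * Suc j))" for j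
  proof -
    have "q n ^ Suc j = (x / (2 * pi)) ^ (2 * Suc j) * (1 / real (Suc n) ^ (2 * Suc j))" for n
      by (simp only: q_def power_divide power_mult times_divide_eq_right mult_1_right)
    then show ?thesis by (simp only:) (intro sums_mult recip_sums, simp)
  qed
  have coef: "2 / x * (-1) ^ j * ((x / (2 * pi)) ^ (2 * Suc j) * recip_sum (2 * Suc j))
      = exp_coeff j * x ^ (2 * j + 1)" for j
    using x by (simp add: exp_coeff_def power_divide field_simps)
  have part: "(\<lambda>n. \<Sum>j<J. 2 / x * (-1) ^ j * q n ^ Suc j) sums (\<Sum>j<J. exp_coeff j * x ^ (2 * j + 1))" for J
    unfolding coef[symmetric] by (intro sums_sum sums_mult Q)
  have rem: "2 / x * (q n / (1 + q n)) - (\<Sum>j<J. 2 / x * (-1) ^ j * q n ^ Suc j)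
     = 2 / x * (-1) ^ J * q n ^ Suc J / (1 + q n)" for n J
  proof (induction J)
    case (Suc J)
    have "1 + q n \<noteq> 0" using q0[of n] by simp
    then have "u / (1 + q n) - u = (-1) * u * q n / (1 + q n)" for u
      by (simp add: field_simps)
    from this[of "2 / x * (-1) ^ J * q n ^ Suc J"] show ?case
      using Suc by (simp add: mult_ac flip: diff_diff_eq)
  qed simp
  have bound: "\<bar>L - (\<Sum>j<J. exp_coeff j * x ^ (2 * j + 1))\<bar> \<le>
      2 / x * ((x / (2 * pi)) ^ (2 * Suc J) * recip_sum (2 * Suc J))" for J
  proof -
    have s: "(\<lambda>n. 2 / x * (-1) ^ J * q n ^ Suc J / (1 + q n)) sums
        (L - (\<Sum>j<J. exp_coeff j * x ^ (2 * j + 1)))"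
      using sums_diff[OF L part[of J]] unfolding rem .
    have s': "(\<lambda>n. 2 / x * q n ^ Suc J) sums
        (2 / x * ((x / (2 * pi)) ^ (2 * Suc J) * recip_sum (2 * Suc J)))"
      by (intro sums_mult Q)
    have le: "\<bar>2 / x * (-1) ^ J * q n ^ Suc J / (1 + q n)\<bar> \<le> 2 / x * q n ^ Suc J" for n
    proof -
      have "\<bar>2 / x * (-1) ^ J * q n ^ Suc J / (1 + q n)\<bar> = 2 / x * q n ^ Suc J / (1 + q n)"
        using x q0[of n] by (simp add: abs_mult power_abs)
      also have "\<dots> \<le> 2 / x * q n ^ Suc J / 1"
        using x q0[of n] by (intro divide_left_mono) auto
      finally show ?thesis by simp
    qed
    show ?thesis
      using sums_le[OF _ s s'] sums_le[OF _ sums_minus[OF s] s'] le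
      by (smt (verit) abs_le_iff)
  qed
  have "(\<lambda>J. L - (\<Sum>j<J. exp_coeff j * x ^ (2 * j + 1))) \<longlonglongrightarrow> 0"
  proof (rule Lim_null_comparison)
    show "\<forall>\<^sub>F J in sequentially. norm (L - (\<Sum>j<J. exp_coeff j * x ^ (2 * j + 1))) \<le> \<bar>exp_coeff J\<bar>"
    proof (intro always_eventually allI)
      fix J
      have "2 / x * ((x / (2 * pi)) ^ (2 * Suc J) * recip_sum (2 * Suc J)) = 
         \<bar>2 / x * (-1) ^ J * ((x / (2 * pi)) ^ (2 * Suc J) * recip_sum (2 * Suc J))\<bar>"
        using x recip_sum_bounds(1)[of "2 * Suc J"] by (simp add: abs_mult power_abs)
      also have "\<dots> = \<bar>exp_coeff J\<bar> * x ^ (2 * J + 1)" 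
        unfolding coef using x by (simp add: abs_mult)
      also have "\<dots> \<le> \<bar>exp_coeff J\<bar> * 1"
        using x by (intro mult_left_mono power_le_one) auto
      finally show "norm (L - (\<Sum>j<J. exp_coeff j * x ^ (2 * j + 1))) \<le> \<bar>exp_coeff J\<bar>"
        using bound[of J] by simp
    qed
    show "(\<lambda>J. \<bar>exp_coeff J\<bar>) \<longlonglongrightarrow> 0"
      by (rule summable_LIMSEQ_zero[OF summable_norm_exp_coeff])
  qed
  then have "(\<lambda>J. L - (L - (\<Sum>j<J. exp_coeff j * x ^ (2 * j + 1)))) \<longlonglongrightarrow> L - 0"
    by (intro tendsto_intros)
  then show ?thesis unfolding sums_def L_def by simp
qed

subsection \<open>Analytic continuation of the zeta function\<close>

text \<open>By the Weierstrass M-test the partial sums converge uniformly on unit discs. The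
  majorant is required only for large \<open>n\<close>, since in one application it fails for terms
  whose index is small compared with \<open>R\<close>.\<close>

lemma suminf_entire:
  fixes f :: "nat \<Rightarrow> complex \<Rightarrow> complex"
  assumes hol: "\<And>n. f n holomorphic_on UNIV"
    and bd: "\<And>R. \<exists>M. summable M \<and> (\<forall>\<^sub>F n in sequentially. \<forall>s\<in>cball 0 R. norm (f n s) \<le> M n)"
  shows "(\<lambda>s. \<Sum>n. f n s) holomorphic_on UNIV"
proof (rule holomorphic_uniform_sequence[of UNIV "\<lambda>n s. \<Sum>k<n. f k s"])
  show "(\<lambda>s. \<Sum>k<n. f k s) holomorphic_on UNIV" for n
    by (intro holomorphic_intros hol)
  show "\<exists>d>0. cball x d \<subseteq> UNIV \<and>
      uniform_limit (cball x d) (\<lambda>n s. \<Sum>k<n. f k s) (\<lambda>s. \<Sum>n. f n s) sequentially" for x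
  proof -
    obtain M where M: "summable M"
      "\<forall>\<^sub>F n in sequentially. \<forall>s\<in>cball 0 (norm x + 1). norm (f n s) \<le> M n"
      using bd by blast
    have sub: "cball x 1 \<subseteq> cball 0 (norm x + 1)"
      by (simp add: subset_iff dist_norm) (metis add.commute norm_triangle_sub norm_minus_commute add_left_mono order_trans)
    have "uniform_limit (cball x 1) (\<lambda>n s. \<Sum>k<n. f k s) (\<lambda>s. \<Sum>n. f n s) sequentially"
      using M(2) sub by (intro Weierstrass_m_test_ev[OF _ M(1)]) (auto elim!: eventually_mono)
    then show ?thesis by (intro exI[of _ 1]) auto
  qed
qed simp

section \<open>The integral over \<open>[1, \<infinity>)\<close> as an entire function\<close>

definition bose_kernel :: "complex \<Rightarrow> real \<Rightarrow> complex" where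
  "bose_kernel s x = of_real x powr (s - 1) * of_real (1 / (exp x - 1))"

lemma continuous_on_bose_kernel:
  assumes "a > 0"
  shows "continuous_on {a..b} (bose_kernel s)"
  unfolding bose_kernel_def using assms by (auto intro!: continuous_intros)

lemma holomorphic_integral_bose_kernel:
  assumes a: "a > 0"
  shows "(\<lambda>s. integral {a..b} (bose_kernel s)) holomorphic_on UNIV"
proof -
  have "(\<lambda>s. integral (cbox a b) (bose_kernel s)) holomorphic_on UNIV"
  \<comment> \<open>Differentiation in \<open>s\<close> brings down the factor \<open>ln x\<close>,
    which is continuous on the interval because \<open>a > 0\<close>.\<close>
  proof (rule leibniz_rule_holomorphic[where fx = "\<lambda>s x. of_real (ln x) * bose_kernel s x"])
    show "((\<lambda>s. bose_kernel s x) has_field_derivative of_real (ln x) * bose_kernel s x) (at s within UNIV)"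
      if "x \<in> cbox a b" for s x
    proof -
      have eq: "bose_kernel w x = exp ((w - 1) * of_real (ln x)) * of_real (1 / (exp x - 1))" for w
      proof -
        have "x > 0" using that a by simp
        then show ?thesis by (simp add: bose_kernel_def powr_def Ln_of_real)
      qed
      have "((\<lambda>w. exp ((w - 1) * of_real (ln x)) * c) has_field_derivative
          of_real (ln x) * (exp ((s - 1) * of_real (ln x)) * c)) (at s within UNIV)" for c :: complex
        by (auto intro!: derivative_eq_intros)
      then show ?thesis unfolding eq .
    qed
    show "bose_kernel s integrable_on cbox a b" for s
      using continuous_on_bose_kernel[OF a] by (auto intro: integrable_continuous_real)
    have "continuous_on (UNIV \<times> cbox a b) (\<lambda>p::complex \<times> real.
        of_real (ln (snd p)) * (exp ((fst p - 1) * of_real (ln (snd p))) * of_real (1 / (exp (snd p) - 1))))"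
      using a by (auto intro!: continuous_intros)
    then show "continuous_on (UNIV \<times> cbox a b) (\<lambda>(s, x). complex_of_real (ln x) * bose_kernel s x)"
      by (rule continuous_on_eq) (use a in \<open>auto simp: bose_kernel_def powr_def Ln_of_real\<close>)
  qed simp
  then show ?thesis by simp
qed

text \<open>For \<open>x \<ge> 1\<close> the power is at most \<open>x ^ K\<close>, and
  \<open>exp x \<ge> 2\<close> gives \<open>1 / (exp x - 1) \<le> 2 / exp x\<close>. The bound
  depends on \<open>s\<close> only through \<open>K\<close>, so it serves as a majorant on a whole
  disc.\<close>

lemma norm_integral_bose_kernel_le:
  assumes s: "Re s \<le> real K"
  shows "norm (integral {real (Suc n)..real (Suc (Suc n))} (bose_kernel s)) \<le>
    2 * (real n + 2) ^ K * exp (- (real n + 1))"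
proof -
  have int: "(bose_kernel s has_integral integral {real (Suc n)..real (Suc (Suc n))} (bose_kernel s))
     {real (Suc n)..real (Suc (Suc n))}"
    by (intro integrable_integral integrable_continuous_real continuous_on_bose_kernel) simp
  have "norm (bose_kernel s x) \<le> 2 * (real n + 2) ^ K * exp (- (real n + 1))"
    if x: "x \<in> {real (Suc n)..real (Suc (Suc n))}" for x
  proof -
    have x1: "x \<ge> 1" "x > 0" using x by auto
    have e: "exp x \<ge> 2" using exp_ge_add_one_self[of x] x1 by linarith
    have "norm (bose_kernel s x) = x powr (Re s - 1) * (1 / (exp x - 1))"
      using x1 e unfolding bose_kernel_def norm_mult norm_of_real by (simp add: norm_powr_real_powr)
    also have "\<dots> \<le> (real n + 2) ^ K * (2 / exp x)"
    proof (intro mult_mono)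
      have "x powr (Re s - 1) \<le> x powr (real K)" using x1 s by (intro powr_mono) auto
      also have "\<dots> = x ^ K" using x1 by (simp add: powr_realpow)
      also have "\<dots> \<le> (real n + 2) ^ K" using x by (intro power_mono) auto
      finally show "x powr (Re s - 1) \<le> (real n + 2) ^ K" .
      have "1 / (exp x - 1) \<le> 1 / (exp x / 2)" using e x1 by (intro divide_left_mono mult_pos_pos) auto
      then show "1 / (exp x - 1) \<le> 2 / exp x" by simp
    qed (use e x1 in auto)
    also have "\<dots> \<le> (real n + 2) ^ K * (2 * exp (- (real n + 1)))"
    proof (intro mult_left_mono)
      have "2 / exp x = 2 * exp (- x)" by (simp add: exp_minus divide_inverse)
      also have "\<dots> \<le> 2 * exp (- (real n + 1))" using x by simp
      finally show "2 / exp x \<le> 2 * exp (- (real n + 1))" .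
    qed simp
    finally show ?thesis by (simp only: mult_ac)
  qed
  from has_integral_bound_real[OF _ finite.emptyI int this] show ?thesis by simp
qed

text \<open>Cutting the half-line into unit intervals replaces an improper integral by a series to
  which the M-test applies, as exponential decay beats the power of \<open>n\<close>.\<close>

lemma suminf_integral_bose_kernel_entire:
  "(\<lambda>s. \<Sum>n. integral {real (Suc n)..real (Suc (Suc n))} (bose_kernel s)) holomorphic_on UNIV"
proof (rule suminf_entire)
  fix R :: real
  obtain K :: nat where K: "R \<le> real K" using real_arch_simple by blast
  let ?M = "\<lambda>n. 2 * (real n + 2) ^ K * exp (- (real n + 1))"
  have "summable ?M"
  proof (rule summable_comparison_test_bigo)
    show "summable (\<lambda>n. norm (1 / (real n ^ 2)))"
      using inverse_power_summable[of 2, where ?'a = real] by (simp add: inverse_eq_divide)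
    show "?M \<in> O(\<lambda>n. 1 / real n ^ 2)" by real_asymp
  qed
  moreover have "norm (integral {real (Suc n)..real (Suc (Suc n))} (bose_kernel s)) \<le> ?M n"
    if "s \<in> cball 0 R" for s n
    using that K complex_Re_le_cmod[of s] by (intro norm_integral_bose_kernel_le) simp
  ultimately show "\<exists>M. summable M \<and> (\<forall>\<^sub>F n in sequentially. \<forall>s\<in>cball 0 R.
      norm (integral {real (Suc n)..real (Suc (Suc n))} (bose_kernel s)) \<le> M n)"
    by (intro exI[of _ ?M]) auto
qed (intro holomorphic_integral_bose_kernel, simp)

text \<open>The entire function \<open>1 / ((s + k) \<Gamma>(s))\<close>, written without the removable singularity at \<open>-k\<close>.\<close>

definition rGamma_quot :: "nat \<Rightarrow> complex \<Rightarrow> complex" where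
  "rGamma_quot k s = pochhammer s k * rGamma (s + of_nat k + 1)"

lemma rGamma_quot_mult: "(s + of_nat k) * rGamma_quot k s = rGamma s"
  using pochhammer_rGamma[of s "Suc k"]
  by (simp add: rGamma_quot_def pochhammer_Suc mult_ac add_ac)

lemma rGamma_quot_eq: "s + of_nat k \<noteq> 0 \<Longrightarrow> rGamma_quot k s = rGamma s / (s + of_nat k)"
  using rGamma_quot_mult[of s k] by (simp add: field_simps)

lemma rGamma_neg_of_nat: "rGamma (- of_nat k :: complex) = 0"
  by (simp add: rGamma_eq_zero_iff)

text \<open>At \<open>- k\<close> the function \<open>rGamma\<close> has a simple zero. Only the
  quotient by \<open>s + k\<close> removes it, leaving the derivative of \<open>rGamma\<close>
  there. This is what isolates a single coefficient of the expansion.\<close>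

lemma rGamma_quot_neg_of_nat:
  "rGamma_quot i (- of_nat k) = (if i = k then (-1) ^ k * fact k else 0)"
proof (cases "i = k")
  case True
  then show ?thesis by (simp add: rGamma_quot_def pochhammer_same)
next
  case False
  then have "- of_nat k + of_nat i \<noteq> (0 :: complex)" by simp
  from rGamma_quot_eq[OF this] False show ?thesis by (simp add: rGamma_neg_of_nat)
qed

lemma holomorphic_rGamma_quot: "rGamma_quot k holomorphic_on UNIV"
  unfolding rGamma_quot_def pochhammer_prod by (auto intro!: holomorphic_intros)

text \<open>If \<open>norm s \<le> R \<le> j\<close>, then \<open>s + 2 * j + 1\<close> has modulus
  at least 1, so the quotient is no larger than \<open>rGamma s\<close>, which is bounded on the
  compact disc.\<close>

lemma suminf_rGamma_quot_entire:
  "(\<lambda>s. \<Sum>j. of_real (exp_coeff j) * rGamma_quot (2 * j + 1) s) holomorphic_on UNIV"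
proof (rule suminf_entire)
  fix R :: real
  have "compact (rGamma ` cball (0 :: complex) R)"
    by (intro compact_continuous_image continuous_on_rGamma) auto
  then obtain B where B: "norm (rGamma s) \<le> B" if "s \<in> cball (0 :: complex) R" for s
    by (force dest!: compact_imp_bounded simp: bounded_iff)
  let ?M = "\<lambda>j. \<bar>exp_coeff j\<bar> * B"
  have "summable ?M" by (intro summable_mult2 summable_norm_exp_coeff)
  moreover have "\<forall>\<^sub>F j in sequentially. \<forall>s\<in>cball 0 R.
      norm (of_real (exp_coeff j) * rGamma_quot (2 * j + 1) s) \<le> ?M j"
    using eventually_ge_at_top[of "nat \<lceil>R\<rceil>"]
  proof (eventually_elim, intro ballI)
    fix j s assume elim: "nat \<lceil>R\<rceil> \<le> j" "s \<in> cball (0 :: complex) R"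
    have "1 \<le> norm (of_nat (2 * j + 1) :: complex) - norm s"
      using elim by (simp only: norm_of_nat) (simp add: nat_le_iff ceiling_le_iff)
    also have "\<dots> \<le> norm (s + of_nat (2 * j + 1))"
      by (metis norm_diff_ineq add.commute)
    finally have ge: "1 \<le> norm (s + of_nat (2 * j + 1))" .
    then have "s + of_nat (2 * j + 1) \<noteq> 0" by (metis norm_zero not_one_le_zero)
    then have "norm (rGamma_quot (2 * j + 1) s) = norm (rGamma s) / norm (s + of_nat (2 * j + 1))"
      by (simp only: rGamma_quot_eq[OF \<open>_ \<noteq> 0\<close>] norm_divide)
    also have "\<dots> \<le> norm (rGamma s) / 1" using ge by (intro divide_left_mono) auto
    also have "\<dots> \<le> B" using B elim by simp
    finally show "norm (of_real (exp_coeff j) * rGamma_quot (2 * j + 1) s) \<le> ?M j"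
      by (simp only: norm_mult norm_of_real) (rule mult_left_mono, auto)
  qed
  ultimately show "\<exists>M. summable M \<and> (\<forall>\<^sub>F j in sequentially. \<forall>s\<in>cball 0 R.
      norm (of_real (exp_coeff j) * rGamma_quot (2 * j + 1) s) \<le> M j)"
    by (intro exI[of _ ?M]) auto
qed (intro holomorphic_intros holomorphic_rGamma_quot)

text \<open>This is \<open>rGamma s\<close> times Riemann's integral. On \<open>[0, 1]\<close> the
  terms \<open>1 / x\<close>, \<open>- 1 / 2\<close> and \<open>c_j * x ^ (2 * j + 1)\<close>
  contribute \<open>1 / (s - 1)\<close>, \<open>- 1 / (2 * s)\<close> and
  \<open>c_j / (s + 2 * j + 1)\<close>; \<open>rGamma_quot\<close> absorbs all these poles except
  \<open>s = 1\<close>.\<close>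

definition zeta_cont :: "complex \<Rightarrow> complex" where
  "zeta_cont s = rGamma s / (s - 1) - rGamma_quot 0 s / 2
     + (\<Sum>j. of_real (exp_coeff j) * rGamma_quot (2 * j + 1) s)
     + rGamma s * (\<Sum>n. integral {real (Suc n)..real (Suc (Suc n))} (bose_kernel s))"

lemma holomorphic_zeta_cont: "zeta_cont holomorphic_on - {1}"
  unfolding zeta_cont_def
  by (intro holomorphic_intros holomorphic_on_subset[OF suminf_rGamma_quot_entire]
      holomorphic_on_subset[OF suminf_integral_bose_kernel_entire]
      holomorphic_on_subset[OF holomorphic_rGamma_quot]) auto

text \<open>The zero of \<open>rGamma\<close> kills the first and last terms, and
  \<open>rGamma_quot 0\<close> vanishes since \<open>k \<noteq> 0\<close>. In the series only the
  index with \<open>2 * j + 1 = k\<close> can survive.\<close>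

lemma zeta_cont_neg:
  assumes "k \<ge> 1"
  shows "zeta_cont (- of_nat k) =
    (if odd k then - of_real (exp_coeff (k div 2)) * fact k else 0)"
proof -
  have "(\<Sum>j. of_real (exp_coeff j) * rGamma_quot (2 * j + 1) (- of_nat k)) =
        (\<Sum>j. if j = k div 2 then (if odd k then - of_real (exp_coeff (k div 2)) * fact k else 0) else (0::complex))"
    unfolding rGamma_quot_neg_of_nat
    by (intro arg_cong[where f = suminf] ext) auto
  also have "\<dots> = (if odd k then - of_real (exp_coeff (k div 2)) * fact k else 0)"
    by (rule sums_unique[symmetric]) (rule sums_single)
  finally show ?thesis
    using assms by (simp add: zeta_cont_def rGamma_neg_of_nat rGamma_quot_neg_of_nat)
qed

section \<open>Riemann's integral in the half-plane \<open>Re s > 1\<close>\<close>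

lemma has_integral_Gamma_scaled:
  assumes s: "Re s > 0" and m: "m > 0"
  shows "((\<lambda>x. of_real x powr (s - 1) / of_real (exp (m * x))) has_integral
           (Gamma s / of_real m powr s)) {0<..}"
proof -
  let ?f = "\<lambda>t. complex_of_real t powr (s - 1) / of_real (exp t)"
  have img: "(*) m ` {0<..} = {0<..}"
  proof -
    have "x \<in> (*) m ` {0<..}" if "x > 0" for x
      using that m by (intro image_eqI[of _ _ "x / m"]) auto
    then show ?thesis using m by auto
  qed
  have "?f absolutely_integrable_on (*) m ` {0<..} \<and> integral ((*) m ` {0<..}) ?f = Gamma s"
    unfolding img using absolutely_integrable_Gamma_integral'[OF s] Gamma_integral_complex'[OF s]
    by (auto intro: integral_unique)
  \<comment> \<open>Euler's integral after the substitution of \<open>m * x\<close> for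
    \<open>x\<close>; dividing by \<open>m powr s\<close> afterwards clears the powers of
    \<open>m\<close>.\<close>
  then have "(\<lambda>x. \<bar>m\<bar> *\<^sub>R ?f (m * x)) absolutely_integrable_on {0<..} \<and>
      integral {0<..} (\<lambda>x. \<bar>m\<bar> *\<^sub>R ?f (m * x)) = Gamma s"
    by (subst has_absolute_integral_change_of_variables_real)
       (use m in \<open>auto intro!: derivative_eq_intros inj_onI\<close>)
  then have "((\<lambda>x. \<bar>m\<bar> *\<^sub>R ?f (m * x)) has_integral Gamma s) {0<..}"
    using set_lebesgue_integral_eq_integral(1) has_integral_iff by blast
  then have "((\<lambda>x. \<bar>m\<bar> *\<^sub>R ?f (m * x) / of_real m powr s) has_integral Gamma s / of_real m powr s) {0<..}"
    by (rule has_integral_divide)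
  moreover have "\<bar>m\<bar> *\<^sub>R ?f (m * x) / of_real m powr s =
      of_real x powr (s - 1) / of_real (exp (m * x))" if "x \<in> {0<..}" for x
    using that m by (simp add: powr_times_real powr_diff scaleR_conv_of_real field_simps)
  ultimately show ?thesis by (rule has_integral_eq[rotated])
qed

lemma exp_geometric_sums:
  fixes x :: real
  assumes "x > 0"
  shows "(\<lambda>m. 1 / exp (real (Suc m) * x)) sums (1 / (exp x - 1))"
proof -
  have eq: "exp (- x) * exp (- x) ^ m = 1 / exp (real (Suc m) * x)" for m
    by (simp add: exp_of_nat_mult[symmetric] exp_minus exp_add field_simps)
  have "(\<lambda>m. exp (- x) * exp (- x) ^ m) sums (exp (- x) * (1 / (1 - exp (- x))))"
    using assms by (intro sums_mult geometric_sums) simp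
  also have "exp (- x) * (1 / (1 - exp (- x))) = 1 / (exp x - 1)"
    using assms by (simp add: exp_minus field_simps)
  finally show ?thesis unfolding eq .
qed

text \<open>Factor \<open>exp x - 1\<close> as \<open>(exp (x / 2) - 1) * (exp (x / 2) + 1)\<close>
  and bound the factors below by \<open>x / 2\<close> and \<open>exp (x / 2)\<close>. The majorant
  keeps both the \<open>1 / x\<close> singularity at 0 and exponential decay.\<close>

lemma bose_factor_le:
  fixes x :: real
  assumes "x > 0"
  shows "1 / (exp x - 1) \<le> 2 / (x * exp (x / 2))"
proof -
  have "x / 2 * exp (x / 2) \<le> (exp (x / 2) - 1) * (exp (x / 2) + 1)"
  proof (intro mult_mono)
    show "x / 2 \<le> exp (x / 2) - 1" using exp_ge_add_one_self[of "x / 2"] by linarith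
  qed (use assms in auto)
  also have "\<dots> = exp x - 1" by (simp add: algebra_simps flip: exp_add)
  finally have "1 / (exp x - 1) \<le> 1 / (x / 2 * exp (x / 2))"
    using assms by (intro divide_left_mono) auto
  then show ?thesis by simp
qed

text \<open>The Bose factor is a geometric series in \<open>exp (- x)\<close>, integrated termwise
  by dominated convergence. Its partial sums stay below \<open>bose_factor_le\<close>, so the
  majorant is a Gamma integrand with parameter \<open>s - 1\<close>, integrable because
  \<open>Re s > 1\<close>.\<close>

lemma bose_kernel_integral:
  assumes s: "Re s > 1"
  shows "bose_kernel s integrable_on {0<..}"
    and "(\<lambda>m. Gamma s / of_nat (Suc m) powr s) sums integral {0<..} (bose_kernel s)"
proof -
  let ?f = "\<lambda>k x. \<Sum>m<k. complex_of_real x powr (s - 1) / of_real (exp (real (Suc m) * x))"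
  let ?h = "\<lambda>x. 2 * norm (complex_of_real x powr ((s - 1) - 1) / of_real (exp (1 / 2 * x)))"
  have f: "(?f k has_integral (\<Sum>m<k. Gamma s / of_nat (Suc m) powr s)) {0<..}" for k
  proof (rule has_integral_sum)
    fix m show "((\<lambda>x. complex_of_real x powr (s - 1) / of_real (exp (real (Suc m) * x)))
        has_integral Gamma s / of_nat (Suc m) powr s) {0<..}"
      using has_integral_Gamma_scaled[of s "real (Suc m)"] s by simp
  qed simp
  have h: "?h integrable_on {0<..}"
    using absolutely_integrable_Gamma_integral[of "s - 1" "1 / 2"] s
    by (intro integrable_on_mult_right) (simp add: absolutely_integrable_on_def)
  have f_eq: "?f k x = of_real x powr (s - 1) * of_real (\<Sum>m<k. 1 / exp (real (Suc m) * x))" for k x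
    by (simp add: sum_distrib_left)
  have le: "norm (?f k x) \<le> ?h x" if x: "x \<in> {0<..}" for k x
  proof -
    have x0: "x > 0" using x by simp
    have "(\<Sum>m<k. 1 / exp (real (Suc m) * x)) \<le> 1 / (exp x - 1)"
      using sum_le_suminf[OF sums_summable[OF exp_geometric_sums[OF x0]], of "{..<k}"]
        sums_unique[OF exp_geometric_sums[OF x0]] by simp
    also have "\<dots> \<le> 2 / (x * exp (x / 2))" by (rule bose_factor_le[OF x0])
    finally have le: "(\<Sum>m<k. 1 / exp (real (Suc m) * x)) \<le> 2 / (x * exp (x / 2))" .
    have "norm (?f k x) = x powr (Re s - 1) * (\<Sum>m<k. 1 / exp (real (Suc m) * x))"
      unfolding f_eq norm_mult norm_of_real using x0
      by (simp add: norm_powr_real_powr sum_nonneg)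
    also have "\<dots> \<le> x powr (Re s - 1) * (2 / (x * exp (x / 2)))"
      using le by (intro mult_left_mono) auto
    also have "\<dots> = ?h x"
      using x0 powr_diff[of x "Re s - 1" 1] unfolding norm_divide norm_of_real
      by (simp add: norm_powr_real_powr)
    finally show ?thesis .
  qed
  have lim: "(\<lambda>k. ?f k x) \<longlonglongrightarrow> bose_kernel s x" if x: "x \<in> {0<..}" for x
    unfolding f_eq bose_kernel_def using exp_geometric_sums[of x] x
    by (intro tendsto_intros) (auto simp: sums_def)
  show "bose_kernel s integrable_on {0<..}"
    by (rule dominated_convergence(1)[OF has_integral_integrable[OF f] h le lim])
  show "(\<lambda>m. Gamma s / of_nat (Suc m) powr s) sums integral {0<..} (bose_kernel s)"
    using dominated_convergence(2)[OF has_integral_integrable[OF f] h le lim]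
    unfolding integral_unique[OF f] sums_def .
qed

lemma has_integral_powr_0_1:
  assumes "Re z > -1"
  shows "((\<lambda>x. of_real x powr z) has_integral (1 / (z + 1))) {0..1::real}"
proof -
  have nz: "z + 1 \<noteq> 0" using assms by (auto simp: complex_eq_iff)
  have "((\<lambda>x. complex_of_real x powr z) has_integral
            (of_real 1 powr (z + 1) / (z + 1) - of_real 0 powr (z + 1) / (z + 1))) {0..1}"
    using assms nz
    by (intro fundamental_theorem_of_calculus_interior)
       (auto intro!: continuous_intros derivative_eq_intros has_vector_derivative_real_field)
  then show ?thesis by simp
qed

text \<open>Termwise integration of \<open>exp_power_series\<close> under a multiple of
  \<open>x powr (Re s - 2)\<close>, which is integrable at 0 because
  \<open>Re s > 1\<close>.\<close>

lemma bose_kernel_integral_0_1: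
  assumes s: "Re s > 1"
  shows "bose_kernel s integrable_on {0..1}"
    and "(\<lambda>j. of_real (exp_coeff j) / (s + of_nat (2 * j + 1))) sums
           (integral {0..1} (bose_kernel s) - 1 / (s - 1) + 1 / (2 * s))"
proof -
  let ?g = "\<lambda>j x. of_real (exp_coeff j) * complex_of_real x powr (s - 1 + of_nat (2 * j + 1))"
  let ?f = "\<lambda>J x. complex_of_real x powr (s - 2) - of_real x powr (s - 1) / 2 + (\<Sum>j<J. ?g j x)"
  let ?I = "\<lambda>J. 1 / (s - 1) - 1 / (2 * s) + (\<Sum>j<J. of_real (exp_coeff j) / (s + of_nat (2 * j + 1)))"
  \<comment> \<open>\<open>3 / 2\<close> collects the coefficients of \<open>1 / x\<close> and
    \<open>- 1 / 2\<close>; the bounded terms are absorbed using \<open>1 / x \<ge> 1\<close> on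
    \<open>(0, 1]\<close>.\<close>
  let ?C = "3 / 2 + (\<Sum>j. \<bar>exp_coeff j\<bar>)"
  let ?h = "\<lambda>x. ?C * x powr (Re s - 2)"
  have f: "(?f J has_integral ?I J) {0..1}" for J
  proof (intro has_integral_add has_integral_diff has_integral_sum)
    show "((\<lambda>x. complex_of_real x powr (s - 2)) has_integral 1 / (s - 1)) {0..1}"
      using has_integral_powr_0_1[of "s - 2"] s by simp
    show "((\<lambda>x. complex_of_real x powr (s - 1) / 2) has_integral 1 / (2 * s)) {0..1}"
      using has_integral_divide[OF has_integral_powr_0_1[of "s - 1"], of 2] s by (simp add: mult.commute)
    show "(?g j has_integral of_real (exp_coeff j) / (s + of_nat (2 * j + 1))) {0..1}" for j
      using has_integral_mult_right[OF has_integral_powr_0_1[of "s - 1 + of_nat (2 * j + 1)"],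
          of "of_real (exp_coeff j)"] s
      by (simp add: algebra_simps)
  qed simp
  have h: "?h integrable_on {0..1}"
    using s by (intro integrable_on_mult_right integrable_on_powr_from_0) auto
  have f_eq: "?f J x = of_real x powr (s - 1) *
      of_real (1 / x - 1 / 2 + (\<Sum>j<J. exp_coeff j * x ^ (2 * j + 1)))" if x: "0 < x" for J x
  proof -
    have "of_real x powr (s - 2) = of_real x powr (s - 1) * of_real (1 / x)"
      using x powr_diff[of "of_real x" "s - 1" 1] by simp
    moreover have "?g j x = of_real x powr (s - 1) * of_real (exp_coeff j * x ^ (2 * j + 1))" for j
    proof -
      have "of_real x powr (s - 1 + of_nat (2 * j + 1)) = of_real x powr (s - 1) * of_real (x ^ (2 * j + 1))"
        using x by (simp only: powr_add powr_nat of_real_power) simp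
      then show ?thesis by simp
    qed
    ultimately show ?thesis
      by (simp only: of_real_add of_real_diff of_real_sum distrib_left right_diff_distrib sum_distrib_left) simp
  qed
  have le: "norm (?f J x) \<le> ?h x" if x: "x \<in> {0..1}" for J x
  \<comment> \<open>At 0 both sides vanish, since \<open>0 powr z = 0\<close> for every
    \<open>z\<close>.\<close>
  proof (cases "x = 0")
    case False
    then have x0: "0 < x" "x \<le> 1" using x by auto
    have "\<bar>\<Sum>j<J. exp_coeff j * x ^ (2 * j + 1)\<bar> \<le> (\<Sum>j<J. \<bar>exp_coeff j\<bar>)"
    proof (rule order_trans[OF sum_abs sum_mono])
      fix j have "x ^ (2 * j + 1) \<le> 1" using x0 by (intro power_le_one) auto
      then show "\<bar>exp_coeff j * x ^ (2 * j + 1)\<bar> \<le> \<bar>exp_coeff j\<bar>"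
        using x0 by (simp add: abs_mult mult_left_le)
    qed
    also have "\<dots> \<le> (\<Sum>j. \<bar>exp_coeff j\<bar>)"
      by (intro sum_le_suminf summable_norm_exp_coeff) auto
    finally have "\<bar>\<Sum>j<J. exp_coeff j * x ^ (2 * j + 1)\<bar> \<le> (\<Sum>j. \<bar>exp_coeff j\<bar>)" .
    moreover have "0 \<le> 1 / x" using x0 by simp
    ultimately have "\<bar>1 / x - 1 / 2 + (\<Sum>j<J. exp_coeff j * x ^ (2 * j + 1))\<bar> \<le>
        1 / x + (1 / 2 + (\<Sum>j. \<bar>exp_coeff j\<bar>)) * 1"
      unfolding mult_1_right by linarith
    also have "\<dots> \<le> 1 / x + (1 / 2 + (\<Sum>j. \<bar>exp_coeff j\<bar>)) * (1 / x)"
      using x0 suminf_nonneg[OF summable_norm_exp_coeff]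
      by (intro add_left_mono mult_left_mono) auto
    also have "\<dots> = ?C * (1 / x)" by (simp add: algebra_simps)
    finally have b: "\<bar>1 / x - 1 / 2 + (\<Sum>j<J. exp_coeff j * x ^ (2 * j + 1))\<bar> \<le> ?C * (1 / x)" .
    have "norm (?f J x) = x powr (Re s - 1) * \<bar>1 / x - 1 / 2 + (\<Sum>j<J. exp_coeff j * x ^ (2 * j + 1))\<bar>"
      unfolding f_eq[OF x0(1)] norm_mult norm_of_real using x0 by (simp add: norm_powr_real_powr)
    also have "\<dots> \<le> x powr (Re s - 1) * (?C * (1 / x))"
      using b by (intro mult_left_mono) auto
    also have "\<dots> = ?h x"
      using x0 powr_diff[of x "Re s - 1" 1] by simp
    finally show ?thesis .
  qed simp
  have lim: "(\<lambda>J. ?f J x) \<longlonglongrightarrow> bose_kernel s x" if x: "x \<in> {0..1}" for x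
  proof (cases "x = 0")
    case False
    then have x0: "0 < x" "x \<le> 1" using x by auto
    have "(\<lambda>J. 1 / x - 1 / 2 + (\<Sum>j<J. exp_coeff j * x ^ (2 * j + 1))) \<longlonglongrightarrow>
        1 / x - 1 / 2 + (1 / (exp x - 1) - 1 / x + 1 / 2)"
      using exp_power_series[OF x0] unfolding sums_def by (intro tendsto_intros)
    then show ?thesis
      unfolding f_eq[OF x0(1)] bose_kernel_def by (intro tendsto_intros) simp
  qed (simp add: bose_kernel_def)
  show "bose_kernel s integrable_on {0..1}"
    by (rule dominated_convergence(1)[OF has_integral_integrable[OF f] h le lim])
  have "?I \<longlonglongrightarrow> integral {0..1} (bose_kernel s)"
    using dominated_convergence(2)[OF has_integral_integrable[OF f] h le lim]
    unfolding integral_unique[OF f] .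
  then have "(\<lambda>J. ?I J - 1 / (s - 1) + 1 / (2 * s)) \<longlonglongrightarrow>
      integral {0..1} (bose_kernel s) - 1 / (s - 1) + 1 / (2 * s)"
    by (intro tendsto_intros)
  then show "(\<lambda>j. of_real (exp_coeff j) / (s + of_nat (2 * j + 1))) sums
           (integral {0..1} (bose_kernel s) - 1 / (s - 1) + 1 / (2 * s))"
    by (simp add: sums_def)
qed

text \<open>Joins the Gamma integrals over the open half-line to the closed intervals;
  \<open>bose_kernel\<close> qualifies through the value of \<open>powr\<close> at 0.\<close>

lemma has_integral_greaterThan_0_iff:
  fixes f :: "real \<Rightarrow> 'a :: euclidean_space"
  assumes "f 0 = 0"
  shows "(f has_integral I) {0<..} \<longleftrightarrow> (f has_integral I) {0..}"
proof -
  have "(f has_integral I) {0<..} \<longleftrightarrow> ((\<lambda>x. if x \<in> {0<..} then f x else 0) has_integral I) {0..}"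
    by (rule has_integral_restrict[symmetric]) auto
  also have "\<dots> \<longleftrightarrow> (f has_integral I) {0..}"
    using assms by (intro has_integral_cong) (auto simp: less_le)
  finally show ?thesis .
qed

text \<open>The truncations of the kernel to \<open>{0..Suc n}\<close> converge pointwise to it and
  are dominated by its norm; their integrals are the one over \<open>{0..1}\<close> plus unit
  pieces.\<close>

lemma bose_kernel_integral_split:
  assumes s: "Re s > 1"
  shows "(\<lambda>n. integral {real (Suc n)..real (Suc (Suc n))} (bose_kernel s)) sums
           (integral {0<..} (bose_kernel s) - integral {0..1} (bose_kernel s))"
proof -
  let ?k = "bose_kernel s"
  let ?f = "\<lambda>n x. if x \<in> {0..real (Suc n)} then ?k x else 0"
  have k: "(?k has_integral integral {0<..} ?k) {0..}"
    using bose_kernel_integral(1)[OF s]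
    by (subst has_integral_greaterThan_0_iff[symmetric]) (auto simp: bose_kernel_def)
  \<comment> \<open>On positive reals the kernel at the real parameter \<open>Re s\<close> is the
    norm of the kernel at \<open>s\<close>, so its integrability yields absolute
    integrability.\<close>
  have "((\<lambda>x. Re (bose_kernel (of_real (Re s)) x)) has_integral
      Re (integral {0<..} (bose_kernel (of_real (Re s))))) {0<..}"
    using bose_kernel_integral(1)[of "of_real (Re s)"] s by (intro has_integral_Re) auto
  moreover have "Re (bose_kernel (of_real (Re s)) x) = norm (?k x)" if "x \<in> {0<..}" for x
  proof -
    have "complex_of_real x powr (of_real (Re s) - 1) = of_real (x powr (Re s - 1))"
      using that by (simp flip: powr_of_real)
    then show ?thesis
      using that unfolding bose_kernel_def norm_mult norm_of_real
      by (simp add: norm_powr_real_powr del: of_real_divide)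
  qed
  ultimately have "((\<lambda>x. norm (?k x)) has_integral
      Re (integral {0<..} (bose_kernel (of_real (Re s))))) {0<..}"
    by (rule has_integral_eq[rotated])
  then have h: "(\<lambda>x. norm (?k x)) integrable_on {0..}"
    by (subst (asm) has_integral_greaterThan_0_iff) (auto simp: bose_kernel_def)
  have split: "integral {0..real (Suc n)} ?k =
     integral {0..1} ?k + (\<Sum>i<n. integral {real (Suc i)..real (Suc (Suc i))} ?k)
     \<and> ?k integrable_on {0..real (Suc n)}" for n
  proof (induction n)
    case 0
    show ?case using bose_kernel_integral_0_1(1)[OF s] by simp
  next
    case (Suc n)
    have i: "?k integrable_on {real (Suc n)..real (Suc (Suc n))}"
      by (intro integrable_continuous_real continuous_on_bose_kernel) simp
    have "?k integrable_on {0..real (Suc (Suc n))}"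
      by (rule Henstock_Kurzweil_Integration.integrable_combine[OF _ _ conjunct2[OF Suc] i]) simp_all
    then show ?case
      using Suc Henstock_Kurzweil_Integration.integral_combine[of 0 "real (Suc n)" "real (Suc (Suc n))" ?k]
      by (simp add: add.assoc[symmetric] del: of_nat_Suc)
  qed
  have f: "(?f n has_integral (integral {0..1} ?k +
      (\<Sum>i<n. integral {real (Suc i)..real (Suc (Suc i))} ?k))) {0..}" for n
    using split[of n] by (subst has_integral_restrict) (auto simp: has_integral_iff)
  have le: "norm (?f n x) \<le> norm (?k x)" for n x by simp
  have lim: "(\<lambda>n. ?f n x) \<longlonglongrightarrow> ?k x" if "x \<in> {0..}" for x
  proof (rule tendsto_eventually)
    show "\<forall>\<^sub>F n in sequentially. ?f n x = ?k x"
      using eventually_ge_at_top[of "nat \<lceil>x\<rceil>"]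
      by eventually_elim (use that in \<open>auto simp: nat_le_iff ceiling_le_iff\<close>)
  qed
  have "(\<lambda>n. integral {0..1} ?k + (\<Sum>i<n. integral {real (Suc i)..real (Suc (Suc i))} ?k))
     \<longlonglongrightarrow> integral {0<..} ?k"
    using dominated_convergence(2)[OF has_integral_integrable[OF f] h le lim]
    unfolding integral_unique[OF f] integral_unique[OF k] .
  then have "(\<lambda>n. integral {0..1} ?k + (\<Sum>i<n. integral {real (Suc i)..real (Suc (Suc i))} ?k)
     - integral {0..1} ?k) \<longlonglongrightarrow> integral {0<..} ?k - integral {0..1} ?k"
    by (intro tendsto_intros)
  then show ?thesis by (simp add: sums_def)
qed

text \<open>For \<open>Re s > 1\<close> the polar terms cancel against those in the integral over
  \<open>[0, 1]\<close>, leaving \<open>rGamma s\<close> times the full integral;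
  \<open>rGamma s * Gamma s = 1\<close> then strips the Gamma factor from its series.\<close>

lemma zeta_cont_sums:
  assumes s: "Re s > 1"
  shows "(\<lambda>n. 1 / of_nat (Suc n) powr s) sums zeta_cont s"
proof -
  let ?I = "integral {0<..} (bose_kernel s)" and ?I1 = "integral {0..1} (bose_kernel s)"
  have G: "rGamma s * Gamma s = 1"
    using s by (auto simp: Gamma_def rGamma_eq_zero_iff elim!: nonpos_Ints_cases intro!: right_inverse)
  have s0: "s + of_nat k \<noteq> 0" for k using s by (auto simp: complex_eq_iff)
  have "(\<lambda>j. rGamma s * (of_real (exp_coeff j) / (s + of_nat (2 * j + 1)))) sums
     (rGamma s * (?I1 - 1 / (s - 1) + 1 / (2 * s)))"
    by (intro sums_mult bose_kernel_integral_0_1 s)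
  then have 1: "(\<Sum>j. of_real (exp_coeff j) * rGamma_quot (2 * j + 1) s) =
     rGamma s * (?I1 - 1 / (s - 1) + 1 / (2 * s))"
    using rGamma_quot_eq[OF s0] by (intro sums_unique[symmetric]) (simp add: mult_ac)
  have 2: "(\<Sum>n. integral {real (Suc n)..real (Suc (Suc n))} (bose_kernel s)) = ?I - ?I1"
    using bose_kernel_integral_split[OF s] by (rule sums_unique[symmetric])
  have "zeta_cont s = rGamma s * ?I"
    using rGamma_quot_eq[of s 0] s0[of 0] unfolding zeta_cont_def 1 2
    by (simp add: algebra_simps)
  moreover have "(\<lambda>m. rGamma s * (Gamma s / of_nat (Suc m) powr s)) sums (rGamma s * ?I)"
    by (intro sums_mult bose_kernel_integral s)
  ultimately show ?thesis using G by simp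
qed

text \<open>The continuation, set to 0 at 1, meets the defining conditions. Any other candidate
  agrees with it where the Dirichlet series converges absolutely, hence on the connected set
  \<open>- {1}\<close> by the identity theorem.\<close>

lemma zeta_eq_zeta_cont:
  assumes "s \<noteq> 1"
  shows "zeta s = zeta_cont s"
proof -
  let ?P = "\<lambda>f. f holomorphic_on - {1} \<and>
      (\<forall>s. Re s > 1 \<longrightarrow> (\<lambda>n. 1 / of_nat (Suc n) powr s) sums f s) \<and> f (1::complex) = (0::complex)"
  let ?f = "\<lambda>s. if s = 1 then 0 else zeta_cont s"
  have f: "?P ?f"
  proof (intro conjI allI impI)
    show "?f holomorphic_on - {1}"
      by (rule holomorphic_transform[OF holomorphic_zeta_cont]) auto
    show "(\<lambda>n. 1 / of_nat (Suc n) powr s) sums ?f s" if "Re s > 1" for s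
      using zeta_cont_sums[OF that] that by (auto simp del: of_nat_Suc)
  qed simp
  have "g = ?f" if g: "?P g" for g
  proof
    fix s
    show "g s = ?f s"
    proof (cases "s = 1")
      case False
      have "open {s. Re s > 1}" by (simp add: open_halfspace_Re_gt)
      moreover have "open (- {1::complex})" by auto
      moreover have "{s. Re s > 1} \<noteq> {}" by (auto intro: exI[of _ 2])
      moreover have "connected (- {1::complex})" by (simp add: connected_punctured_universe)
      moreover have "{s. Re s > 1} \<subseteq> - {1}" by auto
      ultimately show ?thesis
      proof (rule analytic_continuation_open[where g = ?f])
        show "g holomorphic_on - {1}" "?f holomorphic_on - {1}" using f g by blast+
        show "g z = ?f z" if "z \<in> {s. Re s > 1}" for z
        proof (rule sums_unique2)
          show "(\<lambda>n. 1 / of_nat (Suc n) powr z) sums g z" using that g by blast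
          show "(\<lambda>n. 1 / of_nat (Suc n) powr z) sums ?f z" using that f by blast
        qed
        show "s \<in> - {1}" using False by simp
      qed
    qed (use f g in auto)
  qed
  with f have "zeta = ?f" unfolding zeta_def by (rule the_equality)
  from fun_cong[OF this, of s] show ?thesis using assms by simp
qed

lemma zeta_neg:
  assumes "k \<ge> 1"
  shows "zeta (- of_nat k) =
    (if odd k then - of_real (exp_coeff (k div 2)) * fact k else 0)"
proof -
  have "Re (- of_nat k) < Re 1" by simp
  then have "- of_nat k \<noteq> (1 :: complex)" by (metis less_irrefl)
  then show ?thesis using zeta_eq_zeta_cont zeta_cont_neg[OF assms] by metis
qed

subsection \<open>Total variation\<close>

text \<open>The difference \<open>d\<close> of the two normalised weights sums to 0, so its positive
  and negative parts have equal sums, each half the sum of \<open>\<bar>d\<bar>\<close>. If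
  \<open>U \<ge> W\<close>, replacing \<open>U\<close> by \<open>W\<close> only enlarges the
  positive part, which is then at most \<open>v / W\<close>; otherwise the negative part is treated
  likewise.\<close>

lemma infsum_abs_normalized_diff_le:
  fixes u v w :: "'a \<Rightarrow> real"
  assumes u: "(u has_sum U) P" "\<And>j. j \<in> P \<Longrightarrow> u j \<ge> 0" "U > 0"
    and w: "(w has_sum W) P" "\<And>j. j \<in> P \<Longrightarrow> w j \<ge> 0" "W > 0"
    and v: "(v has_sum V) P" "\<And>j. j \<in> P \<Longrightarrow> \<bar>u j - w j\<bar> \<le> v j"
  shows "(\<lambda>j. \<bar>u j / U - w j / W\<bar>) summable_on P"
    and "1 / 2 * (\<Sum>\<^sub>\<infinity>j\<in>P. \<bar>u j / U - w j / W\<bar>) \<le> min 1 (V / W)"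
proof -
  let ?d = "\<lambda>j. u j / U - w j / W"
  have s: "((\<lambda>j. u j / U) has_sum 1) P" "((\<lambda>j. w j / W) has_sum 1) P"
    using has_sum_divide_const[OF u(1), of U] has_sum_divide_const[OF w(1), of W] u(3) w(3) by simp_all
  have d: "(?d has_sum 0) P"
    using has_sum_add[OF s(1) has_sum_cmult_right[OF s(2), of "-1"]] by simp
  have p: "((\<lambda>j. u j / U + w j / W) has_sum 2) P"
    using has_sum_add[OF s] by simp
  have le: "\<bar>?d j\<bar> \<le> u j / U + w j / W" if "j \<in> P" for j
  proof -
    have "0 \<le> u j / U" "0 \<le> w j / W" using u(2,3) w(2,3) that by auto
    then show ?thesis by linarith
  qed
  show sd: "(\<lambda>j. \<bar>?d j\<bar>) summable_on P"
    by (rule summable_on_comparison_test[OF has_sum_imp_summable[OF p]]) (use le in auto)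
  then have sd': "((\<lambda>j. \<bar>?d j\<bar>) has_sum (\<Sum>\<^sub>\<infinity>j\<in>P. \<bar>?d j\<bar>)) P"
    by (rule has_sum_infsum)
  have vw: "((\<lambda>j. 2 * (v j / W)) has_sum 2 * (V / W)) P"
    by (intro has_sum_cmult_right has_sum_divide_const v)
  have "(\<Sum>\<^sub>\<infinity>j\<in>P. \<bar>?d j\<bar>) \<le> 2"
    by (rule has_sum_mono[OF sd' p le])
  moreover have "(\<Sum>\<^sub>\<infinity>j\<in>P. \<bar>?d j\<bar>) \<le> 2 * (V / W)"
  proof (cases "U \<ge> W")
    case True
    have "\<bar>?d j\<bar> + ?d j \<le> 2 * (v j / W)" if j: "j \<in> P" for j
    proof -
      have "u j / U \<le> u j / W" using True u(2)[OF j] w(3) by (intro divide_left_mono) auto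
      then have "?d j \<le> (u j - w j) / W" by (simp add: diff_divide_distrib)
      also have "\<dots> \<le> v j / W" using v(2)[OF j] w(3) by (intro divide_right_mono) auto
      finally have "?d j \<le> v j / W" .
      moreover have "0 \<le> v j / W" using v(2)[OF j] w(3) by (intro divide_nonneg_pos) auto
      ultimately show ?thesis by linarith
    qed
    from has_sum_mono[OF has_sum_add[OF sd' d] vw this] show ?thesis by simp
  next
    case False
    have "\<bar>?d j\<bar> - ?d j \<le> 2 * (v j / W)" if j: "j \<in> P" for j
    proof -
      have "u j / W \<le> u j / U" using False u(2)[OF j] u(3) w(3) by (intro divide_left_mono) auto
      then have "- ?d j \<le> (w j - u j) / W" by (simp add: diff_divide_distrib)
      also have "\<dots> \<le> v j / W" using v(2)[OF j] w(3) by (intro divide_right_mono) auto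
      finally have "- ?d j \<le> v j / W" .
      moreover have "0 \<le> v j / W" using v(2)[OF j] w(3) by (intro divide_nonneg_pos) auto
      ultimately show ?thesis by linarith
    qed
    moreover have "((\<lambda>j. \<bar>?d j\<bar> - ?d j) has_sum (\<Sum>\<^sub>\<infinity>j\<in>P. \<bar>?d j\<bar>)) P"
      using has_sum_add[OF sd' has_sum_cmult_right[OF d, of "-1"]] by (simp add: algebra_simps)
    ultimately show ?thesis using has_sum_mono[OF _ vw] by blast
  qed
  ultimately show "1 / 2 * (\<Sum>\<^sub>\<infinity>j\<in>P. \<bar>?d j\<bar>) \<le> min 1 (V / W)"
    unfolding min.bounded_iff by linarith
qed

section \<open>The explicit weights and their normalisation\<close>

lemma norm_t_coeff:
  assumes N: "even N" and j: "j + 2 \<le> N" and a: "a j \<ge> 0"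
  shows "cmod (t_coeff a N j) = (if even j then fact N / pi ^ N * (w a j * recip_sum (N - j)) else 0)"
proof -
  \<comment> \<open>The zeta argument is \<open>- k\<close> with \<open>k \<ge> 1\<close>. As
    \<open>N\<close> is even, \<open>k\<close> is odd exactly when \<open>j\<close> is even.\<close>
  define k where "k = N - j - 1"
  have k: "k \<ge> 1" "N = Suc (j + k)" using j by (auto simp: k_def)
  have "of_nat j + 1 - of_nat N = (- of_nat k :: complex)" by (simp add: k(2))
  then have t: "t_coeff a N j = of_nat N * of_nat ((N - 1) choose j) * of_real (a j) * 2 ^ k *
      (if odd k then - of_real (exp_coeff (k div 2)) * fact k else 0)"
    unfolding t_coeff_def zeta_neg[OF k(1), symmetric] by (simp add: k_def)
  show ?thesis
  proof (cases "even j")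
    case False
    then have "even k" using N k(2) by simp
    then show ?thesis using False by (simp add: t)
  next
    case True
    then obtain i where i: "k = 2 * i + 1" using N k(2) by (auto elim: oddE)
    have n: "N - j = 2 * i + 2" using i k(2) by simp
    have ki: "k div 2 = i" "odd k" using i by auto
    have "cmod (t_coeff a N j) = real N * real ((N - 1) choose j) * a j * 2 ^ k * (\<bar>exp_coeff i\<bar> * fact k)"
      using a ki by (simp add: t norm_mult norm_power)
    also have "real ((N - 1) choose j) = fact (N - 1) / (fact j * fact k)"
      using k(2) by (simp add: binomial_fact)
    also have "real N * (fact (N - 1) / (fact j * fact k)) * a j * 2 ^ k * (\<bar>exp_coeff i\<bar> * fact k)
       = real N * fact (N - 1) * a j / fact j * (2 ^ k * \<bar>exp_coeff i\<bar>)"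
      by simp
    also have "real N * fact (N - 1) = fact N"
      using k(2) by simp
    \<comment> \<open>Here \<open>2 * 2 ^ k = 2 ^ (N - j)\<close> cancels the power of 2 in
      \<open>(2 * pi) ^ (N - j)\<close>.\<close>
    also have "2 ^ k * \<bar>exp_coeff i\<bar> = recip_sum (N - j) * (1 / pi ^ (N - j))"
      unfolding abs_exp_coeff n i by (simp add: power_mult_distrib)
    also have "1 / pi ^ (N - j) = pi ^ j / pi ^ N"
      using j by (simp add: power_diff)
    finally show ?thesis using True by (simp add: w_def mult_ac)
  qed
qed

text \<open>The growth bound on \<open>a\<close> gives the exponential series of
  \<open>\<rho> * t\<close>, times \<open>C\<close>, as a majorant.\<close>

lemma E_has_sum:
  assumes a: "a 0 = 0" "\<forall>j\<ge>1. a j \<ge> 0"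
    and bd: "\<exists>C>0. \<exists>\<rho>>0. \<forall>j. a j \<le> C * \<rho> ^ j" and t: "t \<ge> 0"
  shows "((\<lambda>j. a j * t ^ j / fact j) has_sum E a t) pos_evens"
proof -
  obtain C \<rho> where C: "C > 0" "\<rho> > 0" "\<And>j. a j \<le> C * \<rho> ^ j" using bd by blast
  have a0: "a j \<ge> 0" for j using a by (cases "j = 0") auto
  have "summable (\<lambda>j. norm (a j * t ^ j / fact j))"
  proof (rule summable_comparison_test')
    show "summable (\<lambda>j. C * (inverse (fact j) * (\<rho> * t) ^ j))"
      by (intro summable_mult summable_exp)
    fix j
    have "a j * t ^ j / fact j \<le> C * \<rho> ^ j * t ^ j / fact j"
      using C t by (intro divide_right_mono mult_right_mono) auto
    then show "norm (norm (a j * t ^ j / fact j)) \<le> C * (inverse (fact j) * (\<rho> * t) ^ j)"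
      using a0 t by (simp add: power_mult_distrib field_simps)
  qed
  then have "(\<lambda>j. a j * t ^ j / fact j) summable_on pos_evens"
    by (intro summable_on_subset_banach[OF norm_summable_imp_summable_on]) auto
  then show ?thesis unfolding E_def by (rule has_sum_infsum)
qed

lemma total_variation_p_fin:
  assumes a: "a 0 = 0" "\<forall>j\<ge>1. a j \<ge> 0" "a 2 > 0"
    and bd: "\<exists>C>0. \<exists>\<rho>>0. \<forall>j. a j \<le> C * \<rho> ^ j"
    and N: "N \<ge> 4" "even N"
  shows "(\<lambda>j. \<bar>p_fin a N j - p_lim a j\<bar>) summable_on pos_evens"
    and "1 / 2 * (\<Sum>\<^sub>\<infinity>j\<in>pos_evens. \<bar>p_fin a N j - p_lim a j\<bar>)
      \<le> min 1 (3 * E a (2 * pi) / D a * 2 powi (- int N))"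
proof -
  define A where "A = {j \<in> pos_evens. j \<le> N - 2}"
  define u where "u j = (if j \<in> A then w a j * recip_sum (N - j) else 0)" for j
  define U where "U = sum u A"
  \<comment> \<open>The pointwise error bound \<open>3 * w_j * 2 ^ j / 2 ^ N\<close>; the factor
    \<open>2 ^ j\<close> turns the terms of \<open>E a pi\<close> into those of
    \<open>E a (2 * pi)\<close>.\<close>
  define v where "v j = 3 / 2 ^ N * (a j * (2 * pi) ^ j / fact j)" for j
  have a0: "a j \<ge> 0" for j using a by (cases "j = 0") auto
  have w0: "w a j \<ge> 0" for j using a0 by (simp add: w_def)
  have w2: "w a 2 > 0" using a by (simp add: w_def)
  have A: "finite A" "A \<subseteq> pos_evens" by (auto simp: A_def)
  have z1: "1 \<le> recip_sum (N - j)" "recip_sum (N - j) \<le> 1 + 3 / 2 ^ (N - j)" if "j \<in> A" for j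
    using recip_sum_bounds[of "N - j"] that N by (auto simp: A_def)
  have u0: "u j \<ge> 0" for j using w0 z1[of j] by (auto simp: u_def)
  have "2 \<in> A" using N by (auto simp: A_def pos_evens_def)
  then have "u 2 > 0" using w2 z1(1)[of 2] by (simp add: u_def)
  moreover have "u 2 \<le> U" unfolding U_def using \<open>2 \<in> A\<close> A u0 by (intro member_le_sum) auto
  ultimately have U: "U > 0" by simp
  have u_sum: "(u has_sum U) pos_evens"
    unfolding U_def using A by (intro has_sum_finite_neutralI) (auto simp: u_def)
  have w_sum: "(w a has_sum D a) pos_evens"
    using E_has_sum[OF a(1,2) bd, of pi] by (simp add: w_def[abs_def] D_def)
  have "w a 2 \<le> D a"
    using has_sum_mono2[OF has_sum_finite[of "{2}" "w a"] w_sum] w0 by (auto simp: pos_evens_def)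
  then have D: "D a > 0" using w2 by simp
  have v_sum: "(v has_sum 3 / 2 ^ N * E a (2 * pi)) pos_evens"
    unfolding v_def by (intro has_sum_cmult_right E_has_sum a bd) simp
  have v_eq: "v j = w a j * (3 * 2 ^ j / 2 ^ N)" for j
    by (simp add: v_def w_def power_mult_distrib mult_ac)
  have uv: "\<bar>u j - w a j\<bar> \<le> v j" if j: "j \<in> pos_evens" for j
  proof (cases "j \<in> A")
    case True
    then have "j \<le> N" by (auto simp: A_def)
    then have "(3::real) / 2 ^ (N - j) = 3 * 2 ^ j / 2 ^ N" by (simp add: power_diff)
    then have "w a j * (recip_sum (N - j) - 1) \<le> v j"
      unfolding v_eq using z1(2)[OF True] w0 by (intro mult_left_mono) auto
    moreover have "u j - w a j = w a j * (recip_sum (N - j) - 1)"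
      using True by (simp add: u_def algebra_simps)
    moreover have "0 \<le> w a j * (recip_sum (N - j) - 1)"
      using z1(1)[OF True] w0 by simp
    ultimately show ?thesis by simp
  next
    case False
    \<comment> \<open>Both indices are even, so \<open>j > N - 2\<close> forces
      \<open>j \<ge> N\<close>. There \<open>u j = 0\<close>, and the error \<open>w a j\<close> is
      covered because \<open>3 * 2 ^ j / 2 ^ N \<ge> 1\<close>.\<close>
    then have "N \<le> j" using j N unfolding A_def pos_evens_def by simp presburger
    then have "(2::real) ^ N \<le> 2 ^ j" by (intro power_increasing) auto
    moreover have "(0::real) \<le> 2 ^ j" by simp
    ultimately have "(2::real) ^ N \<le> 3 * 2 ^ j" by linarith
    then have "(1::real) \<le> 3 * 2 ^ j / 2 ^ N" by (simp add: le_divide_eq)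
    then have "w a j * 1 \<le> v j" unfolding v_eq using w0 by (intro mult_left_mono)
    then show ?thesis using False w0 by (simp add: u_def)
  qed
  \<comment> \<open>The common factor \<open>fact N / pi ^ N\<close> cancels in the quotient by
    \<open>M a N\<close>; odd indices contribute 0 to both sums.\<close>
  have p: "p_fin a N j = u j / U" for j
  proof -
    let ?c = "fact N / pi ^ N :: real"
    have c: "?c > 0" by simp
    have t: "cmod (t_coeff a N i) = ?c * u i" if "i \<in> {1..N - 2}" for i
    proof -
      have "i \<in> A \<longleftrightarrow> even i"
        using that unfolding A_def pos_evens_def by simp presburger
      then show ?thesis using norm_t_coeff[of N i a] N a0 that by (auto simp: u_def)
    qed
    have "M a N = ?c * (\<Sum>i = 1..N - 2. u i)"
      unfolding M_def sum_distrib_left by (rule sum.cong[OF refl t])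
    also have "(\<Sum>i = 1..N - 2. u i) = U"
      unfolding U_def by (rule sum.mono_neutral_right) (auto simp: A_def pos_evens_def u_def)
    finally have "M a N = ?c * U" .
    then show ?thesis
      using t[of j] c by (auto simp: p_fin_def u_def A_def pos_evens_def)
  qed
  have bound: "3 / 2 ^ N * E a (2 * pi) / D a = 3 * E a (2 * pi) / D a * 2 powi (- int N)"
    by (simp add: power_int_minus field_simps)
  note * = infsum_abs_normalized_diff_le[OF u_sum u0 U w_sum w0 D v_sum uv]
  show "(\<lambda>j. \<bar>p_fin a N j - p_lim a j\<bar>) summable_on pos_evens"
    using *(1) by (simp add: p p_lim_def)
  show "1 / 2 * (\<Sum>\<^sub>\<infinity>j\<in>pos_evens. \<bar>p_fin a N j - p_lim a j\<bar>)
      \<le> min 1 (3 * E a (2 * pi) / D a * 2 powi (- int N))"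
    using *(2) unfolding bound by (simp add: p p_lim_def)
qed

theorem theorem6:
  fixes a :: "nat \<Rightarrow> real"
  assumes "a 0 = 0"
    and "\<forall>j\<ge>1. a j \<ge> 0"
    and "a 2 > 0"
    and "\<exists>C>0. \<exists>\<rho>>0. \<forall>j. a j \<le> C * \<rho> ^ j"
  shows "(\<forall>N\<ge>4. even N \<longrightarrow>
            (\<lambda>j. \<bar>p_fin a N j - p_lim a j\<bar>) summable_on pos_evens \<and>
            1 / 2 * (\<Sum>\<^sub>\<infinity>j\<in>pos_evens. \<bar>p_fin a N j - p_lim a j\<bar>)
              \<le> min 1 (3 * E a (2 * pi) / D a * 2 powi (- int N)))
       \<and> uniform_limit pos_evens (\<lambda>N. p_fin a N) (p_lim a)
            (inf at_top (principal {N. even N}))"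
proof (intro conjI allI impI)
  show sm: "(\<lambda>j. \<bar>p_fin a N j - p_lim a j\<bar>) summable_on pos_evens"
    and bd: "1 / 2 * (\<Sum>\<^sub>\<infinity>j\<in>pos_evens. \<bar>p_fin a N j - p_lim a j\<bar>)
      \<le> min 1 (3 * E a (2 * pi) / D a * 2 powi (- int N))" if "4 \<le> N" "even N" for N
    using total_variation_p_fin[OF assms that] by blast+
  let ?K = "3 * E a (2 * pi) / D a"
  show "uniform_limit pos_evens (\<lambda>N. p_fin a N) (p_lim a) (inf at_top (principal {N. even N}))"
  proof (rule uniform_limitI)
    fix e :: real assume "e > 0"
    \<comment> \<open>The factor 2 undoes the \<open>1 / 2\<close> of the total variation.\<close>
    have "(\<lambda>N. 2 * ?K * (1 / 2) ^ N) \<longlonglongrightarrow> 2 * ?K * 0"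
      by (intro tendsto_mult tendsto_const LIMSEQ_realpow_zero) auto
    then have "\<forall>\<^sub>F N in sequentially. 2 * ?K * (1 / 2) ^ N < e"
      using \<open>e > 0\<close> by (intro order_tendstoD) auto
    then have "\<forall>\<^sub>F N in sequentially. even N \<longrightarrow> (\<forall>j\<in>pos_evens. dist (p_fin a N j) (p_lim a j) < e)"
      using eventually_ge_at_top[of 4]
    proof (eventually_elim, intro impI ballI)
      fix N j
      assume small: "2 * ?K * (1 / 2) ^ N < e" and N: "4 \<le> N" "even N" and j: "j \<in> pos_evens"
      \<comment> \<open>A single term is at most the whole sum of absolute differences, which makes
        the bound uniform in \<open>j\<close>.\<close>
      have "dist (p_fin a N j) (p_lim a j) = (\<Sum>i\<in>{j}. \<bar>p_fin a N i - p_lim a i\<bar>)"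
        by (simp add: dist_real_def)
      also have "\<dots> \<le> (\<Sum>\<^sub>\<infinity>i\<in>pos_evens. \<bar>p_fin a N i - p_lim a i\<bar>)"
        by (rule finite_sum_le_infsum[OF sm[OF N]]) (use j in auto)
      also have "\<dots> \<le> 2 * ?K * (1 / 2) ^ N"
        using bd[OF N] by (simp add: power_int_minus power_one_over inverse_eq_divide)
      finally show "dist (p_fin a N j) (p_lim a j) < e" using small by simp
    qed
    then show "\<forall>\<^sub>F N in inf at_top (principal {N. even N}).
        \<forall>j\<in>pos_evens. dist (p_fin a N j) (p_lim a j) < e"
      by (simp add: eventually_inf_principal)
  qed
qed

end
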